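(* Let $f(n)$ denote the number of partitions of the positive integer $n$ in which the nonzero multiplicities of the distinct parts are pairwise different. Then $$\ln f(n) \sim \frac{6^{1/3}}{3}\, n^{1/3}\ln n \sim (6n)^{1/3}\ln\big[(6n)^{1/3}\big] \qquad \text{as } n\to\infty.$$
   Context: A partition of $n$ can be written as $n=m_1p_1+\cdots+m_rp_r$ where $p_1<\cdots<p_r$ are the distinct parts and $m_i\ge 1$ is the multiplicity of part $p_i$. The partitions counted by $f(n)$ are those for which $m_1,\dots,m_r$ are pairwise distinct. Here $a(n)\sim b(n)$ means $a(n)/b(n)\to 1$. *)

theory Defs
  imports Complex_Main "HOL-Library.Multiset" "HOL-Library.Landau_Symbols"
begin

text \<open>
  A partition of \<open>n\<close> is the finite multiset of its parts; \<open>set_mset P\<close> is the set of distinct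
  parts and \<open>count P p\<close> is the multiplicity of the part \<open>p\<close>.
\<close>

definition partitions :: "nat \<Rightarrow> nat multiset set" where
  "partitions n = {P. (\<forall>p\<in>#P. p \<ge> 1) \<and> \<Sum>\<^sub># P = n}"

definition distinct_mults :: "nat multiset \<Rightarrow> bool" where
  "distinct_mults P \<longleftrightarrow> inj_on (count P) (set_mset P)"

definition distinct_mult_count :: "nat \<Rightarrow> nat" where
  "distinct_mult_count n = card {P \<in> partitions n. distinct_mults P}"

lemma size_le_sum_mset:
  fixes P :: "nat multiset"
  assumes "\<forall>p\<in>#P. p \<ge> 1"
  shows "size P \<le> \<Sum>\<^sub># P"
  using assms by (induction P) auto

lemma finite_partitions: "finite (partitions n)"
proof (rule finite_subset)
  show "partitions n \<subseteq> mset ` {xs. set xs \<subseteq> {..n} \<and> length xs \<le> n}"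
  proof
    fix P assume P: "P \<in> partitions n"
    obtain xs where xs: "P = mset xs"
      using ex_mset[of P] by auto
    have "length xs \<le> n"
      using P size_le_sum_mset[of P] by (auto simp: partitions_def xs)
    moreover have "set xs \<subseteq> {..n}"
      using P by (auto simp: partitions_def xs sum_mset_sum_list member_le_sum_list)
    ultimately show "P \<in> mset ` {xs. set xs \<subseteq> {..n} \<and> length xs \<le> n}"
      using xs by auto
  qed
  show "finite (mset ` {xs. set xs \<subseteq> {..n} \<and> length xs \<le> n})"
    by (intro finite_imageI finite_lists_length_le) auto
qed

end

theory Submission
  imports Defs "HOL-Real_Asymp.Real_Asymp" "HOL-Combinatorics.Permutations"
    "HOL-Analysis.Harmonic_Numbers"
begin

text \<open>
  Upper bound: if \<open>r\<close> distinct parts have distinct multiplicities, then by rearrangement the sum is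
  at least \<open>1\<cdot>r + 2\<cdot>(r-1) + \<dots> + r\<cdot>1 = r(r+1)(r+2)/6\<close>, so \<open>r \<le> R = (6n)\<^bsup>1/3\<^esup>\<close>. Identify a
  partition with its set of pairs (multiplicity, part) and weight each pair \<open>(m,p)\<close> by
  \<open>t exp(-smp)\<close>, where \<open>s > 0\<close> and \<open>0 < t \<le> 1\<close>; this bounds the number of partitions by
  \<open>exp(sn) t\<^bsup>-R\<^esup> \<Prod>(1 + t exp(-smp))\<close>. The choice \<open>s = n\<^bsup>-2/3\<^esup>\<close>, \<open>t = n\<^bsup>-1/3\<^esup> / (1 + ln n)\<^sup>2\<close>
  makes everything except \<open>t\<^bsup>-R\<^esup>\<close> at most \<open>exp(2n\<^bsup>1/3\<^esup>)\<close>.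

  Lower bound: start from the extremal configuration pairing large parts with small
  multiplicities, cut it into \<open>k\<close> blocks of length \<open>b\<close>, and permute the multiplicities freely
  inside each block. This costs only a factor \<open>1 + O(1/k)\<close> in the sum and yields \<open>(b!)\<^sup>k\<close>
  configurations. The part \<open>1\<close> is kept in reserve and absorbs the rest of \<open>n\<close>. Taking
  \<open>k \<approx> ln n\<close> and \<open>b \<approx> (6n)\<^bsup>1/3\<^esup> / k\<close> matches the upper bound.
\<close>

section \<open>Rearrangement bound for distinct multiplicities\<close>

lemma sum_mset_conv_sum_count:
  fixes P :: "nat multiset"
  assumes "finite S" "set_mset P \<subseteq> S"
  shows "\<Sum>\<^sub># P = (\<Sum>p\<in>S. count P p * p)"
  using assms(2)
proof (induction P)
  case (add x P)
  have "(\<Sum>p\<in>S. count (add_mset x P) p * p) = (\<Sum>p\<in>S. count P p * p + (if p = x then x else 0))"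
    by (intro sum.cong) auto
  also have "\<dots> = (\<Sum>p\<in>S. count P p * p) + x"
    using add.prems assms(1) by (subst sum.distrib) (simp add: sum.delta')
  finally show ?case using add by simp
qed simp

lemma sum_positive_set_ge:
  fixes S :: "nat set"
  assumes "finite S" "0 \<notin> S"
  shows "card S * (card S + 1) \<le> 2 * \<Sum>S"
  using assms
proof (induction S rule: finite_linorder_max_induct)
  case (insert b A)
  have "A \<subseteq> {1..<b}" using insert by (auto simp: Suc_le_eq intro: gr0I)
  hence "card A \<le> b - 1" using card_mono[of "{1..<b}" A] by simp
  hence "card A + 1 \<le> b" using insert.prems by (cases b) auto
  thus ?case using insert by (auto simp: algebra_simps)
qed simp

text \<open>Induction on the number of parts: delete the part \<open>q\<close> of least multiplicity
  and lower the other multiplicities by one. What is removed amounts to at least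
  \<open>\<Sum>S\<close>, and by \<open>sum_positive_set_ge\<close> this pays for the step from
  \<open>r\<close> to \<open>r + 1\<close>.\<close>

lemma sum_distinct_mults_ge:
  fixes m :: "nat \<Rightarrow> nat"
  assumes "finite S" "0 \<notin> S" "inj_on m S" "\<And>p. p \<in> S \<Longrightarrow> m p > 0"
  shows "card S * (card S + 1) * (card S + 2) \<le> 6 * (\<Sum>p\<in>S. m p * p)"
  using assms
proof (induction "card S" arbitrary: S m)
  case (Suc r)
  hence "S \<noteq> {}" by auto
  then obtain q where q: "q \<in> S" "\<And>p. p \<in> S \<Longrightarrow> m q \<le> m p"
    using ex_min_if_finite[of "m ` S"] Suc.prems(1)
    by (metis arg_min_if_finite(1) arg_min_least)
  define T where "T = S - {q}"
  have T: "finite T" "card T = r" "S = insert q T" "q \<notin> T"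
    using Suc.prems(1) Suc.hyps(2) q(1) by (auto simp: T_def)
  \<comment> \<open>The multiplicity of \<open>q\<close> is strictly least, so on \<open>T\<close>
    lowering by one leaves positive values and truncated subtraction keeps them distinct.\<close>
  have gt: "m p > 1" if "p \<in> T" for p
  proof -
    have "m p \<noteq> m q" using that T q Suc.prems(3) by (auto simp: inj_on_def)
    thus ?thesis using q(2)[of p] that T Suc.prems(4)[of q] by auto
  qed
  have "card T * (card T + 1) * (card T + 2) \<le> 6 * (\<Sum>p\<in>T. (m p - 1) * p)"
  proof (rule Suc.hyps(1))
    show "inj_on (\<lambda>p. m p - 1) T"
      using Suc.prems(3) gt T by (auto simp: inj_on_def) (metis One_nat_def Suc_pred' less_trans zero_less_one)
  qed (use T Suc.prems gt in auto)
  moreover have "card S * (card S + 1) \<le> 2 * \<Sum>S"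
    using Suc.prems by (intro sum_positive_set_ge)
  moreover have "(\<Sum>p\<in>S. m p * p) \<ge> \<Sum>S + (\<Sum>p\<in>T. (m p - 1) * p)"
  proof -
    have "(\<Sum>p\<in>T. m p * p) = (\<Sum>p\<in>T. p + (m p - 1) * p)"
      using gt by (intro sum.cong refl) (metis One_nat_def Suc_pred' less_trans mult_Suc zero_less_one)
    moreover have "q \<le> m q * q" using Suc.prems(4)[of q] q(1) by simp
    ultimately show ?thesis using T by (simp add: sum.distrib)
  qed
  moreover have "card S = r + 1" using Suc.hyps(2) by simp
  ultimately show ?case using T(2) by (simp add: algebra_simps)
qed simp

section \<open>Upper bound by weighted counting\<close>

text \<open>Rankin's trick: a partition with \<open>r\<close> distinct parts has weight
  \<open>t ^ r * exp (- s * n)\<close>, and since \<open>r \<le> R\<close> and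
  \<open>t \<le> 1\<close> the prefactor lifts this to at least 1. The weights of all subsets of the
  grid sum to the product.\<close>

lemma distinct_mult_count_le_prod:
  fixes s t R :: real
  assumes t: "0 < t" "t \<le> 1" and R: "R = (6 * real n) powr (1/3)"
  shows "real (distinct_mult_count n) \<le>
    exp (s * n) * t powr (-R) * (\<Prod>(m,p)\<in>{1..n}\<times>{1..n}. 1 + t * exp (- s * (real m * real p)))"
proof -
  define g where "g = (\<lambda>P. (\<lambda>p. (count P p, p)) ` set_mset P :: (nat \<times> nat) set)"
  define F where "F = {P \<in> partitions n. distinct_mults P}"
  define w where "w = (\<lambda>(m,p). t * exp (- s * (real m * real p)))"
  let ?A = "{1..n} \<times> {1..n}"
  have inj: "inj_on g F"
  proof (rule inj_onI)
    fix P Q assume eq: "g P = g Q"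
    \<comment> \<open>A positive count is read off from a pair; count 0 shows as the absence of any
      pair with that part.\<close>
    have "count P p = c \<and> c > 0 \<longleftrightarrow> (c, p) \<in> g P" for P c p
      by (auto simp: g_def)
    hence "count P p = c \<and> c > 0 \<longleftrightarrow> count Q p = c \<and> c > 0" for p c
      using eq by metis
    hence "count P p = count Q p" for p by (metis gr0I)
    thus "P = Q" by (rule multiset_eqI)
  qed
  have g: "g P \<in> Pow ?A" "(\<Sum>(m,p)\<in>g P. m * p) = n" "real (card (g P)) \<le> R" if "P \<in> F" for P
  proof -
    have P: "\<And>p. p \<in># P \<Longrightarrow> p \<ge> 1" "\<Sum>\<^sub># P = n" "inj_on (count P) (set_mset P)"
      using that by (auto simp: F_def partitions_def distinct_mults_def)
    have sum: "n = (\<Sum>p\<in>set_mset P. count P p * p)"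
      using P(2) sum_mset_conv_sum_count[of "set_mset P" P] by simp
    have inj': "inj_on (\<lambda>p. (count P p, p)) (set_mset P)"
      by (auto simp: inj_on_def)
    show "(\<Sum>(m,p)\<in>g P. m * p) = n"
      unfolding g_def by (subst sum.reindex[OF inj']) (simp add: sum)
    have le: "count P p * p \<le> n" if "p \<in># P" for p
      unfolding sum using that by (intro member_le_sum) auto
    show "g P \<in> Pow ?A"
    proof -
      have "1 \<le> count P p \<and> count P p \<le> n \<and> 1 \<le> p \<and> p \<le> n" if "p \<in># P" for p
      proof -
        have "count P p \<ge> 1" "p \<ge> 1" using that P(1) by (auto simp: Suc_le_eq)
        moreover from this have "count P p \<le> count P p * p" "p \<le> count P p * p" by auto
        ultimately show ?thesis using le[OF that] by linarith
      qed
      thus ?thesis by (auto simp: g_def)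
    qed
    define r where "r = card (g P)"
    have "card (g P) = card (set_mset P)" unfolding g_def by (rule card_image[OF inj'])
    hence "r * (r + 1) * (r + 2) \<le> 6 * n"
      unfolding r_def sum using sum_distinct_mults_ge[of "set_mset P" "count P"] P by fastforce
    moreover have "r ^ 3 \<le> r * (r + 1) * (r + 2)" by (simp add: power3_eq_cube algebra_simps)
    ultimately have "r ^ 3 \<le> 6 * n" by linarith
    hence "real r ^ 3 \<le> 6 * real n" by (metis of_nat_le_iff of_nat_mult of_nat_numeral of_nat_power)
    hence "(real r ^ 3) powr (1/3) \<le> R" unfolding R by (intro powr_mono2) auto
    moreover have "(real r ^ 3) powr (1/3) = real r"
      by (cases "r = 0") (simp_all add: powr_powr flip: powr_numeral)
    ultimately show "real (card (g P)) \<le> R" by (simp add: r_def)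
  qed
  have wpos: "w x > 0" for x using t by (auto simp: w_def split: prod.split)
  have one: "1 \<le> exp (s * n) * t powr (-R) * prod w (g P)" if "P \<in> F" for P
  proof -
    have "prod w (g P) = t ^ card (g P) * (\<Prod>x\<in>g P. exp (- s * real (fst x * snd x)))"
      by (simp add: w_def case_prod_unfold prod.distrib)
    also have "(\<Prod>x\<in>g P. exp (- s * real (fst x * snd x))) = exp (- s * real (\<Sum>x\<in>g P. fst x * snd x))"
      by (subst exp_sum[symmetric]) (auto simp: g_def sum_distrib_left)
    also have "(\<Sum>x\<in>g P. fst x * snd x) = n" using g(2)[OF that] by (simp add: case_prod_unfold)
    finally have "exp (s * n) * t powr (-R) * prod w (g P) = t powr (card (g P) - R)"
      using t by (simp add: exp_minus powr_diff powr_minus powr_realpow field_simps)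
    moreover have "t powr 0 \<le> t powr (card (g P) - R)"
      using t g(3)[OF that] by (intro powr_mono') auto
    ultimately show ?thesis using t by simp
  qed
  have "real (distinct_mult_count n) = (\<Sum>P\<in>F. 1)"
    by (simp add: distinct_mult_count_def F_def)
  also have "\<dots> \<le> (\<Sum>P\<in>F. exp (s * n) * t powr (-R) * prod w (g P))"
    by (intro sum_mono one)
  also have "\<dots> = exp (s * n) * t powr (-R) * (\<Sum>X\<in>g ` F. prod w X)"
    by (simp add: sum.reindex[OF inj] sum_distrib_left)
  also have "\<dots> \<le> exp (s * n) * t powr (-R) * (\<Sum>X\<in>Pow ?A. prod w X)"
    using g(1) wpos by (intro mult_left_mono sum_mono2 prod_nonneg) (auto intro: less_imp_le)
  also have "(\<Sum>X\<in>Pow ?A. prod w X) = (\<Prod>x\<in>?A. w x + 1)"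
    by (subst prod_add) auto
  finally show ?thesis by (simp add: w_def case_prod_unfold add.commute)
qed

lemma harm_le_one_plus_ln: "n > 0 \<Longrightarrow> harm n \<le> 1 + ln (real n)"
  using decseqD[OF decseq_harm_diff_ln, of 0 "n - 1"] by (simp add: harm_expand)

text \<open>With this \<open>s\<close>, the factor \<open>exp (s * n)\<close> contributes only
  \<open>n powr (1/3)\<close>; the square of \<open>1 + ln n\<close> in \<open>t\<close> cancels the
  bound for the squared harmonic sum. What remains, \<open>R * (- ln t)\<close>, contains the main
  term.\<close>

lemma ln_distinct_mult_count_le:
  assumes "n > 0" "distinct_mult_count n > 0"
  shows "ln (real (distinct_mult_count n)) \<le> 2 * real n powr (1/3) +
    (6 * real n) powr (1/3) * (ln (real n) / 3 + 2 * ln (1 + ln (real n)))"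
proof -
  define x where "x = real n"
  define s where "s = x powr (-2/3)"
  define t where "t = x powr (-1/3) / (1 + ln x)\<^sup>2"
  define R where "R = (6 * x) powr (1/3)"
  let ?A = "{1..n} \<times> {1..n}"
  let ?w = "\<lambda>m p. t * exp (- s * (real m * real p))"
  have x: "x \<ge> 1" using assms by (simp add: x_def)
  hence lx: "ln x \<ge> 0" by simp
  have s: "s > 0" using x by (simp add: s_def)
  have l1: "1 + ln x > 0" using lx by simp
  have t: "t > 0" unfolding t_def using x l1 by (intro divide_pos_pos zero_less_power) auto
  have "x powr (-1/3) \<le> 1" using x powr_mono[of "-1/3" 0 x] by simp
  moreover have "(1 + ln x)\<^sup>2 \<ge> 1" using lx by simp
  ultimately have "x powr (-1/3) \<le> (1 + ln x)\<^sup>2" by linarith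
  hence t1: "t \<le> 1" unfolding t_def using l1 by (subst divide_le_eq_1_pos) auto
  have w0: "?w m p \<ge> 0" for m p using t by simp
  have "(\<Sum>(m,p)\<in>?A. ?w m p) \<le> (\<Sum>(m,p)\<in>?A. t / s * ((1 / real m) * (1 / real p)))"
  proof (intro sum_mono, clarify)
    fix m p assume "m \<in> {1..n}" "p \<in> {1..n}"
    hence mp: "s * (real m * real p) > 0" using s by auto
    \<comment> \<open>The resulting bound \<open>exp (-u) \<le> 1 / u\<close> separates
      \<open>m\<close> from \<open>p\<close>, so the double sum factors into
      \<open>(harm n)^2\<close>.\<close>
    have "s * (real m * real p) \<le> exp (s * (real m * real p))"
      using exp_ge_add_one_self[of "s * (real m * real p)"] by linarith
    hence "exp (- (s * (real m * real p))) \<le> 1 / (s * (real m * real p))"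
      using mp by (simp add: exp_minus field_simps)
    thus "?w m p \<le> t / s * ((1 / real m) * (1 / real p))"
      using t mult_left_mono[of _ _ t] by fastforce
  qed
  also have "\<dots> = t / s * (\<Sum>(m,p)\<in>?A. (1 / real m) * (1 / real p))"
    by (simp only: sum_distrib_left case_prod_unfold)
  also have "(\<Sum>(m,p)\<in>?A. (1 / real m) * (1 / real p)) = (harm n)\<^sup>2"
    by (simp add: harm_def power2_eq_square sum_product sum.cartesian_product inverse_eq_divide)
  also have "t / s * (harm n)\<^sup>2 \<le> t / s * (1 + ln x)\<^sup>2"
    using s t harm_le_one_plus_ln[of n] assms
    by (intro mult_left_mono power_mono) (auto simp: x_def harm_nonneg)
  also have "\<dots> = x powr (1/3)"
    using l1 x by (simp add: t_def s_def flip: powr_diff)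
  finally have sum: "(\<Sum>(m,p)\<in>?A. ?w m p) \<le> x powr (1/3)" .
  have "(\<Prod>(m,p)\<in>?A. 1 + ?w m p) \<le> (\<Prod>(m,p)\<in>?A. exp (?w m p))"
  proof (intro prod_mono, clarify)
    fix m p
    show "0 \<le> 1 + ?w m p \<and> 1 + ?w m p \<le> exp (?w m p)"
      using w0[of m p] exp_ge_add_one_self[of "?w m p"] by linarith
  qed
  also have "\<dots> = exp (\<Sum>(m,p)\<in>?A. ?w m p)"
    by (subst exp_sum) (auto simp: case_prod_unfold)
  also have "\<dots> \<le> exp (x powr (1/3))" using sum by simp
  finally have prod: "(\<Prod>(m,p)\<in>?A. 1 + ?w m p) \<le> exp (x powr (1/3))" .
  have "real (distinct_mult_count n) \<le> exp (s * n) * t powr (-R) * (\<Prod>(m,p)\<in>?A. 1 + ?w m p)"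
    using t t1 by (intro distinct_mult_count_le_prod) (simp_all add: R_def x_def)
  also have "\<dots> \<le> exp (s * n) * t powr (-R) * exp (x powr (1/3))"
    by (intro mult_left_mono prod) auto
  finally have "ln (real (distinct_mult_count n)) \<le> ln (exp (s * n) * t powr (-R) * exp (x powr (1/3)))"
    using assms by simp
  also have "\<dots> = s * x + R * (- ln t) + x powr (1/3)"
    using t by (simp add: ln_mult ln_powr x_def)
  also have "s * x = x powr (1/3)"
    using x powr_add[of x "-2/3" 1] by (simp add: s_def)
  also have "- ln t = ln x / 3 + 2 * ln (1 + ln x)"
    using x l1 by (simp add: t_def ln_div ln_powr ln_realpow less_imp_neq[THEN not_sym])
  finally show ?thesis by (simp add: R_def x_def)
qed

section \<open>Blockwise permuted multiplicities\<close>

text \<open>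
  The pairs are indexed by \<open>i < k * b\<close>: the part \<open>i + 2\<close> lies in block \<open>i div b\<close> and gets the
  multiplicity below, which lies in the \<open>(k - 1 - i div b)\<close>-th block of \<open>{1..k * b}\<close>.
\<close>

definition block_mult :: "nat \<Rightarrow> nat \<Rightarrow> (nat \<Rightarrow> nat \<Rightarrow> nat) \<Rightarrow> nat \<Rightarrow> nat" where
  "block_mult b k \<sigma> i = 1 + (k - 1 - i div b) * b + \<sigma> (i div b) (i mod b)"

definition block_perms :: "nat \<Rightarrow> nat \<Rightarrow> (nat \<Rightarrow> nat \<Rightarrow> nat) set" where
  "block_perms b k = (\<Pi>\<^sub>E j\<in>{..<k}. {\<pi>. \<pi> permutes {..<b}})"

lemma card_block_perms: "card (block_perms b k) = fact b ^ k"
  by (simp add: block_perms_def card_PiE card_permutations[OF refl])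

lemma block_index:
  fixes b k i :: nat
  assumes "i < k * b"
  shows "i div b < k" "i mod b < b" "b > 0"
proof -
  show "b > 0" using assms by (cases b) auto
  thus "i mod b < b" by simp
  show "i div b < k" using assms by (rule less_mult_imp_div_less)
qed

lemma block_perms_less:
  assumes "\<sigma> \<in> block_perms b k" "j < k" "i < b"
  shows "\<sigma> j i < b"
proof -
  have "\<sigma> j permutes {..<b}" using assms by (auto simp: block_perms_def PiE_iff)
  thus ?thesis using assms(3) permutes_in_image[of "\<sigma> j" "{..<b}" i] by simp
qed

lemma block_mult_le:
  assumes "\<sigma> \<in> block_perms b k" "i < k * b"
  shows "block_mult b k \<sigma> i \<le> (k - i div b) * b"
proof -
  note * = block_index[OF assms(2)]
  have "k - i div b = Suc (k - 1 - i div b)" using *(1) by linarith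
  thus ?thesis using block_perms_less[OF assms(1) *(1,2)]
    by (simp add: block_mult_def)
qed

text \<open>Division by \<open>b\<close> recovers the block, since the permuted term is below
  \<open>b\<close>. The lemma serves twice: \<open>\<sigma> = \<tau>\<close> yields distinct
  multiplicities, \<open>i = i'\<close> recovers the permutations.\<close>

lemma block_mult_eqD:
  assumes "\<sigma> \<in> block_perms b k" "\<tau> \<in> block_perms b k" "i < k * b" "i' < k * b"
    and "block_mult b k \<sigma> i = block_mult b k \<tau> i'"
  shows "i div b = i' div b" "\<sigma> (i div b) (i mod b) = \<tau> (i' div b) (i' mod b)"
proof -
  note i = block_index[OF assms(3)] and i' = block_index[OF assms(4)]
  let ?u = "\<sigma> (i div b) (i mod b)" and ?v = "\<tau> (i' div b) (i' mod b)"
  have less: "?u < b" "?v < b" using assms i i' by (auto intro: block_perms_less)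
  have eq: "(k - 1 - i div b) * b + ?u = (k - 1 - i' div b) * b + ?v"
    using assms(5) by (simp add: block_mult_def)
  hence "((k - 1 - i div b) * b + ?u) div b = ((k - 1 - i' div b) * b + ?v) div b" by simp
  hence "k - 1 - i div b = k - 1 - i' div b" using less by simp
  \<comment> \<open>Both block indices are at most \<open>k - 1\<close>, so truncated subtraction
    loses nothing.\<close>
  thus "i div b = i' div b" using i(1) i'(1) by linarith
  with eq show "?u = ?v" by simp
qed

lemma inj_on_block_mult:
  assumes "\<sigma> \<in> block_perms b k"
  shows "inj_on (block_mult b k \<sigma>) {..<k * b}"
proof (rule inj_onI)
  fix i i' assume *: "i \<in> {..<k * b}" "i' \<in> {..<k * b}" "block_mult b k \<sigma> i = block_mult b k \<sigma> i'"
  have **: "i div b = i' div b" "\<sigma> (i div b) (i mod b) = \<sigma> (i' div b) (i' mod b)"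
    using block_mult_eqD[OF assms assms _ _ *(3)] *(1,2) by blast+
  have "\<sigma> (i div b) permutes {..<b}"
    using assms block_index(1)[of i k b] * by (auto simp: block_perms_def PiE_iff)
  hence "i mod b = i' mod b" using ** by (metis permutes_inj injD)
  thus "i = i'" using ** by (metis div_mult_mod_eq)
qed

text \<open>Passing from \<open>k\<close> to \<open>k + 1\<close> raises each \<open>k - j\<close>
  by one. The first sum is the extremal sum of the upper bound, now over blocks; hence the matching
  constants.\<close>

lemma sum_block_products:
  "6 * (\<Sum>j<k. (k - j) * (j + 1)) = k * (k + 1) * (k + (2::nat))"
  "2 * (\<Sum>j<k. k - j) = k * (k + (1::nat))"
proof (induction k)
  case (Suc k)
  have eq: "(\<Sum>j<k. Suc k - j) = (\<Sum>j<k. (k - j) + 1)" by (intro sum.cong) auto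
  {
    case 1
    have "(\<Sum>j<k. (Suc k - j) * (j + 1)) = (\<Sum>j<k. (k - j) * (j + 1) + (j + 1))"
      by (intro sum.cong) (auto simp: Suc_diff_le)
    also have "\<dots> = (\<Sum>j<k. (k - j) * (j + 1)) + (\<Sum>j<k. j + 1)" by (rule sum.distrib)
    finally have "6 * (\<Sum>j<k. (Suc k - j) * (j + 1)) = k * (k + 1) * (k + 2) + 6 * (\<Sum>j<k. j + 1)"
      using Suc(1) by simp
    moreover have "2 * (\<Sum>j<k. j + 1) = k * (k + 1)" by (induction k) auto
    ultimately show ?case by (simp add: algebra_simps)
  next
    case 2
    have "(\<Sum>j<k. Suc k - j) = (\<Sum>j<k. k - j) + k"
      unfolding eq by (subst sum.distrib) simp
    thus ?case using Suc(2) by simp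
  }
qed simp_all

text \<open>In block \<open>j\<close> every multiplicity is at most \<open>(k - j) * b\<close> and
  every part at most \<open>(j + 1) * b + 1\<close>, whatever the permutations. This rounding
  inflates the leading term only from about \<open>(b * k)^3\<close> to
  \<open>(b * (k + 1))^3\<close>.\<close>

lemma sum_block_mult_le:
  assumes "\<sigma> \<in> block_perms b k"
  shows "6 * (\<Sum>i<k * b. block_mult b k \<sigma> i * (i + 2)) \<le> (b * (k + 1)) ^ 3 + 3 * (b * (k + 1)) ^ 2"
proof -
  define h where "h = (\<lambda>j. (k - j) * b * ((j + 1) * b + 1))"
  have "(\<Sum>i<k * b. block_mult b k \<sigma> i * (i + 2)) \<le> (\<Sum>i<k * b. h (i div b))"
  proof (rule sum_mono)
    fix i assume i: "i \<in> {..<k * b}"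
    hence "i mod b < b" using block_index[of i k b] by simp
    moreover have "i = i div b * b + i mod b" by simp
    ultimately have "i + 1 \<le> i div b * b + b" by linarith
    hence "i + 2 \<le> (i div b + 1) * b + 1" by simp
    thus "block_mult b k \<sigma> i * (i + 2) \<le> h (i div b)"
      unfolding h_def using block_mult_le[OF assms, of i] i by (intro mult_mono) auto
  qed
  also have "\<dots> = (\<Sum>j<k. \<Sum>i\<in>{j * b..<j * b + b}. h (i div b))" by (rule sum.nat_group[symmetric])
  also have "\<dots> = (\<Sum>j<k. b * h j)"
  proof (rule sum.cong[OF refl])
    fix j
    have "i div b = j" if "i \<in> {j * b..<j * b + b}" for i
      using that by (intro div_nat_eqI) (auto simp: algebra_simps)
    hence "(\<Sum>i\<in>{j * b..<j * b + b}. h (i div b)) = (\<Sum>i\<in>{j * b..<j * b + b}. h j)"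
      by (intro sum.cong) auto
    thus "(\<Sum>i\<in>{j * b..<j * b + b}. h (i div b)) = b * h j" by simp
  qed
  also have "\<dots> = b^3 * (\<Sum>j<k. (k - j) * (j + 1)) + b^2 * (\<Sum>j<k. k - j)"
    unfolding h_def sum_distrib_left sum.distrib[symmetric]
    by (intro sum.cong refl) (simp only: power3_eq_cube power2_eq_square ring_distribs mult_1_right mult_ac add_ac)
  finally have "6 * (\<Sum>i<k * b. block_mult b k \<sigma> i * (i + 2)) \<le>
      b^3 * (6 * (\<Sum>j<k. (k - j) * (j + 1))) + 3 * (b^2 * (2 * (\<Sum>j<k. k - j)))" by simp
  also have "\<dots> = b^3 * (k * (k + 1) * (k + 2)) + 3 * (b^2 * (k * (k + 1)))"
    by (simp only: sum_block_products)
  also have "\<dots> \<le> b^3 * (k + 1) ^ 3 + 3 * (b^2 * (k + 1) ^ 2)"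
    by (intro add_mono mult_mono) (auto simp: power3_eq_cube power2_eq_square algebra_simps)
  finally show ?thesis by (simp only: power_mult_distrib)
qed

section \<open>Partitions built from block permutations\<close>

text \<open>The part 1 takes up the remainder \<open>n - W \<sigma>\<close>. The \<open>+ 2\<close>
  in the hypothesis makes this remainder exceed \<open>r\<close>, hence every block
  multiplicity.\<close>

lemma fact_power_le_distinct_mult_count:
  assumes "(b * (k + 1) + 2) ^ 3 \<le> 6 * n"
  shows "fact b ^ k \<le> distinct_mult_count n"
proof -
  define r where "r = k * b"
  define W where "W = (\<lambda>\<sigma>. \<Sum>i<r. block_mult b k \<sigma> i * (i + 2))"
  define c where "c = (\<lambda>\<sigma> p. if p = 1 then n - W \<sigma> else if p \<in> {2..<r + 2} then block_mult b k \<sigma> (p - 2) else 0)"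
  define M where "M = (\<lambda>\<sigma>. Abs_multiset (c \<sigma>))"
  let ?S = "insert 1 {2..<r + 2}"
  have W: "W \<sigma> + r < n" if "\<sigma> \<in> block_perms b k" for \<sigma>
  proof -
    define y where "y = b * (k + 1)"
    have "6 * W \<sigma> \<le> y ^ 3 + 3 * y ^ 2"
      using sum_block_mult_le[OF that] by (simp add: W_def r_def y_def)
    moreover have "r \<le> y" by (simp add: r_def y_def algebra_simps)
    \<comment> \<open>The surplus over \<open>y ^ 3\<close> covers both the error
      \<open>3 * y ^ 2\<close> and \<open>6 * r \<le> 6 * y\<close>.\<close>
    moreover have "(y + 2) ^ 3 = y ^ 3 + 6 * y ^ 2 + 12 * y + 8"
      by (simp add: power3_eq_cube power2_eq_square algebra_simps)
    ultimately show ?thesis using assms unfolding y_def[symmetric] by linarith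
  qed
  have count: "count (M \<sigma>) = c \<sigma>" for \<sigma>
    unfolding M_def by (rule count_Abs_multiset, rule finite_subset[of _ ?S]) (auto simp: c_def)
  have set: "set_mset (M \<sigma>) = ?S" if "\<sigma> \<in> block_perms b k" for \<sigma>
    using W[OF that] by (auto simp: set_mset_def count c_def block_mult_def)
  have "M \<sigma> \<in> {P \<in> partitions n. distinct_mults P}" if \<sigma>: "\<sigma> \<in> block_perms b k" for \<sigma>
  proof -
    have "\<Sum>\<^sub># (M \<sigma>) = (\<Sum>p\<in>?S. c \<sigma> p * p)"
      using sum_mset_conv_sum_count[of ?S "M \<sigma>"] set[OF \<sigma>] by (simp add: count)
    also have "\<dots> = n - W \<sigma> + (\<Sum>p\<in>{0 + 2..<r + 2}. block_mult b k \<sigma> (p - 2) * p)"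
      by (subst sum.insert) (auto simp: c_def intro!: sum.cong)
    also have "(\<Sum>p\<in>{0 + 2..<r + 2}. block_mult b k \<sigma> (p - 2) * p) = W \<sigma>"
      unfolding sum.shift_bounds_nat_ivl by (simp add: W_def atLeast0LessThan)
    finally have "\<Sum>\<^sub># (M \<sigma>) = n" using W[OF \<sigma>] by simp
    moreover have "inj_on (c \<sigma>) ?S"
    proof -
      have le: "block_mult b k \<sigma> i \<le> r" if "i < r" for i
        using order_trans[OF block_mult_le[OF \<sigma>, of i] mult_le_mono1[of "k - i div b" k b]] that
        by (simp add: r_def)
      have "inj_on (c \<sigma>) {2..<r + 2}"
      proof (rule inj_onI)
        fix p q assume pq: "p \<in> {2..<r + 2}" "q \<in> {2..<r + 2}" "c \<sigma> p = c \<sigma> q"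
        hence "block_mult b k \<sigma> (p - 2) = block_mult b k \<sigma> (q - 2)" by (simp add: c_def)
        moreover have "p - 2 \<in> {..<k * b}" "q - 2 \<in> {..<k * b}" using pq by (auto simp: r_def)
        ultimately have "p - 2 = q - 2" by (rule inj_onD[OF inj_on_block_mult[OF \<sigma>]])
        thus "p = q" using pq by auto
      qed
      moreover have "c \<sigma> 1 \<noteq> c \<sigma> p" if "p \<in> {2..<r + 2}" for p
      proof -
        have "p - 2 < r" using that by auto
        hence "block_mult b k \<sigma> (p - 2) \<le> r" by (rule le)
        moreover have "c \<sigma> p = block_mult b k \<sigma> (p - 2)" "c \<sigma> 1 = n - W \<sigma>"
          using that by (auto simp: c_def)
        ultimately show ?thesis using W[OF \<sigma>] by linarith
      qed
      ultimately show ?thesis unfolding inj_on_insert by blast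
    qed
    ultimately show ?thesis using set[OF \<sigma>] by (auto simp: partitions_def distinct_mults_def count)
  qed
  moreover have "inj_on M (block_perms b k)"
  proof (rule inj_onI)
    fix \<sigma> \<tau> assume \<sigma>: "\<sigma> \<in> block_perms b k" and \<tau>: "\<tau> \<in> block_perms b k" and "M \<sigma> = M \<tau>"
    hence c: "c \<sigma> = c \<tau>" using count by metis
    have "\<sigma> j i = \<tau> j i" if "j < k" "i < b" for i j
    proof -
      have "j * b + i < Suc j * b" using that by simp
      also have "\<dots> \<le> k * b" using that by (intro mult_le_mono1) auto
      finally have r: "j * b + i < r" by (simp add: r_def)
      \<comment> \<open>The count of the part \<open>j * b + i + 2\<close> reveals entry
        \<open>i\<close> of block \<open>j\<close>.\<close>
      hence "block_mult b k \<sigma> (j * b + i) = block_mult b k \<tau> (j * b + i)"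
        using fun_cong[OF c, of "j * b + i + 2"] by (simp add: c_def)
      from block_mult_eqD(2)[OF \<sigma> \<tau> _ _ this] r that show ?thesis by (simp add: r_def)
    qed
    \<comment> \<open>Equality of functions also concerns arguments outside \<open>{..<b}\<close>,
      which the permutations fix.\<close>
    moreover have "\<sigma> j i = \<tau> j i" if "j < k" "\<not> i < b" for i j
    proof -
      have "\<sigma> j permutes {..<b}" "\<tau> j permutes {..<b}"
        using \<sigma> \<tau> that by (auto simp: block_perms_def PiE_iff)
      thus ?thesis using that by (simp add: permutes_not_in)
    qed
    ultimately have "\<sigma> j = \<tau> j" if "j < k" for j using that by blast
    thus "\<sigma> = \<tau>" using \<sigma> \<tau> unfolding block_perms_def by (intro PiE_ext) auto
  qed
  ultimately have "card (block_perms b k) \<le> distinct_mult_count n"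
    unfolding distinct_mult_count_def
    by (intro card_inj_on_le[of M]) (auto simp: finite_partitions)
  thus ?thesis by (simp add: card_block_perms)
qed

section \<open>Logarithmic lower bound\<close>

text \<open>The induction step comes down to \<open>b * ln (1 + 1 / b) \<le> 1\<close>; this is the
  elementary Stirling bound.\<close>

lemma ln_fact_ge: "ln (fact b :: real) \<ge> real b * (ln (real b) - 1)"
proof (induction b)
  case (Suc b)
  show ?case
  proof (cases "b = 0")
    case False
    have "1 + 1 / real b = real (Suc b) / real b" using False by (simp add: field_simps)
    hence "ln (real (Suc b)) - ln (real b) = ln (1 + 1 / real b)"
      using False by (simp only: ln_div of_nat_0_less_iff) (simp add: ln_div)
    also have "\<dots> \<le> 1 / real b" by (intro ln_add_one_self_le_self) auto
    finally have "real b * (ln (real (Suc b)) - ln (real b)) \<le> 1"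
      using False by (simp add: field_simps)
    moreover have "ln (fact (Suc b) :: real) = ln (real (Suc b)) + ln (fact b)"
      unfolding fact_Suc by (subst ln_mult) auto
    ultimately show ?thesis using Suc by (simp add: algebra_simps)
  qed simp
qed simp

text \<open>Take \<open>k = \<lfloor>L\<rfloor>\<close> and the largest \<open>b\<close> with
  \<open>b * (k + 1) + 2 \<le> (6 * n) powr (1/3)\<close>. Then \<open>\<beta>\<close> bounds
  \<open>b\<close> from below without rounding: \<open>L\<close> replaces \<open>k\<close>, and
  subtracting 1 absorbs the floor.\<close>

lemma ln_distinct_mult_count_ge:
  fixes n :: nat
  defines "L \<equiv> ln (real n)"
  defines "\<beta> \<equiv> ((6 * real n) powr (1/3) - 2) / (L + 1) - 1"
  assumes "L \<ge> 1" "\<beta> \<ge> exp 1"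
  shows "distinct_mult_count n > 0" "(L - 1) * (\<beta> * (ln \<beta> - 1)) \<le> ln (real (distinct_mult_count n))"
proof -
  define x where "x = (6 * real n) powr (1/3)"
  define k where "k = nat \<lfloor>L\<rfloor>"
  define q where "q = (x - 2) / (real k + 1)"
  define b where "b = nat \<lfloor>q\<rfloor>"
  have k: "real k \<le> L" "L - 1 \<le> real k" using assms(3) unfolding k_def by linarith+
  have \<beta>: "\<beta> > 0" using assms(4) exp_gt_zero[of "1::real"] by linarith
  have x2: "x - 2 \<ge> 0"
  proof (rule ccontr)
    assume "\<not> x - 2 \<ge> 0"
    hence "(x - 2) / (L + 1) \<le> 0" using assms(3) by (intro divide_nonpos_pos) auto
    thus False using \<beta> by (simp add: \<beta>_def x_def)
  qed
  have "(x - 2) / (L + 1) \<le> q" unfolding q_def using k x2 by (intro divide_left_mono) auto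
  hence \<beta>q: "\<beta> \<le> q - 1" by (simp add: \<beta>_def x_def)
  hence b: "real b \<le> q" "\<beta> \<le> real b" using \<beta> unfolding b_def by linarith+
  have "real b * (real k + 1) \<le> x - 2" using b(1) by (simp add: q_def field_simps)
  hence "(real b * (real k + 1) + 2) ^ 3 \<le> x ^ 3" by (intro power_mono) auto
  also have "x ^ 3 = 6 * real n" by (cases "n = 0") (simp_all add: x_def powr_powr flip: powr_numeral)
  finally have "real ((b * (k + 1) + 2) ^ 3) \<le> real (6 * n)" by (simp add: algebra_simps)
  hence "(b * (k + 1) + 2) ^ 3 \<le> 6 * n" by (simp only: of_nat_le_iff)
  hence le: "fact b ^ k \<le> distinct_mult_count n" by (rule fact_power_le_distinct_mult_count)
  thus pos: "distinct_mult_count n > 0" by (metis fact_gt_zero gr0I le_zero_eq power_not_zero less_numeral_extra(3))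
  \<comment> \<open>This keeps \<open>ln \<beta> - 1\<close> nonnegative, so the factors can be
    bounded separately.\<close>
  have "ln \<beta> \<ge> 1" using assms(4) \<beta> by (simp add: ln_ge_iff)
  moreover have "ln \<beta> \<le> ln (real b)" using b(2) \<beta> by simp
  ultimately have "(L - 1) * (\<beta> * (ln \<beta> - 1)) \<le> real k * (real b * (ln (real b) - 1))"
    using assms(3) k b \<beta> by (intro mult_mono) auto
  also have "\<dots> \<le> real k * ln (fact b)" by (intro mult_left_mono ln_fact_ge) auto
  also have "\<dots> = ln (real (fact b ^ k))" by (simp add: ln_realpow)
  also have "\<dots> \<le> ln (real (distinct_mult_count n))"
    using le pos by (subst ln_le_cancel_iff) (auto simp del: of_nat_power of_nat_fact)
  finally show "(L - 1) * (\<beta> * (ln \<beta> - 1)) \<le> ln (real (distinct_mult_count n))" .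
qed

section \<open>Asymptotic equivalence\<close>

theorem mainTheorem1:
  shows "(\<lambda>n::nat. ln (real (distinct_mult_count n))) \<sim>[at_top]
           (\<lambda>n. 6 powr (1/3) / 3 * real n powr (1/3) * ln (real n))
       \<and> (\<lambda>n::nat. 6 powr (1/3) / 3 * real n powr (1/3) * ln (real n)) \<sim>[at_top]
           (\<lambda>n. (6 * real n) powr (1/3) * ln ((6 * real n) powr (1/3)))"
proof
  define \<beta> where "\<beta> = (\<lambda>n::nat. ((6 * real n) powr (1/3) - 2) / (ln (real n) + 1) - 1)"
  let ?g = "\<lambda>n::nat. 6 powr (1/3) / 3 * real n powr (1/3) * ln (real n)"
  show "(\<lambda>n::nat. ln (real (distinct_mult_count n))) \<sim>[at_top] ?g"
  proof (rule asymp_equiv_sandwich_real)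
    \<comment> \<open>Here \<open>\<beta> n * ln n\<close> grows like
      \<open>(6 * n) powr (1/3)\<close>, and \<open>ln (\<beta> n)\<close> like
      \<open>ln n / 3\<close>.\<close>
    show "(\<lambda>n. (ln (real n) - 1) * (\<beta> n * (ln (\<beta> n) - 1))) \<sim>[at_top] ?g"
      unfolding \<beta>_def by real_asymp
    \<comment> \<open>The first summand and the iterated logarithm are of lower order.\<close>
    show "(\<lambda>n. 2 * real n powr (1/3) +
      (6 * real n) powr (1/3) * (ln (real n) / 3 + 2 * ln (1 + ln (real n)))) \<sim>[at_top] ?g"
      by real_asymp
    have "eventually (\<lambda>n. \<beta> n \<ge> exp 1) at_top" unfolding \<beta>_def by real_asymp
    moreover have "eventually (\<lambda>n::nat. ln (real n) \<ge> 1) at_top" by real_asymp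
    moreover have "eventually (\<lambda>n::nat. n > 0) at_top" by (rule eventually_gt_at_top)
    ultimately show "eventually (\<lambda>n. ln (real (distinct_mult_count n)) \<in>
      {(ln (real n) - 1) * (\<beta> n * (ln (\<beta> n) - 1))..2 * real n powr (1/3) +
      (6 * real n) powr (1/3) * (ln (real n) / 3 + 2 * ln (1 + ln (real n)))}) at_top"
    proof eventually_elim
      case (elim n)
      thus ?case using ln_distinct_mult_count_ge[of n] ln_distinct_mult_count_le[of n]
        by (simp add: \<beta>_def)
    qed
  qed
  \<comment> \<open>The two sides differ only by the constant \<open>ln 6 / 3\<close> beside
    \<open>ln n / 3\<close>.\<close>
  show "?g \<sim>[at_top] (\<lambda>n. (6 * real n) powr (1/3) * ln ((6 * real n) powr (1/3)))"
    by real_asymp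
qed

end
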